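(* Let $N\ge 1$, $\mathbf h=[h_1,\dots,h_N]^T\in\mathbb C^N$ with $\mathbf h\neq \mathbf 0$, and let $\sigma_\theta^2,\sigma_w^2,\sigma_{v,1}^2,\dots,\sigma_{v,N}^2,P,P_T>0$. Let $\mathbf H=\mathrm{diag}\{h_1,\dots,h_N\}$, $\mathbf V=\mathrm{diag}\{\sigma_{v,1}^2,\dots,\sigma_{v,N}^2\}$, $\mathbf D=\mathrm{diag}\{\sigma_\theta^2+\sigma_{v,1}^2,\dots,\sigma_\theta^2+\sigma_{v,N}^2\}$, and $$\mathbf B=\mathbf H\mathbf V\mathbf H^H+\frac{\sigma_w^2}{P_T}\mathbf D .$$ Consider the problem of minimizing the filtered mean squared error $$\mathrm{MSE}(\mathbf a)=\left(1-\frac{P\,\mathbf a^H\mathbf h\mathbf h^H\mathbf a}{\mathbf a^H\mathbf H\mathbf V\mathbf H^H\mathbf a+P\,\mathbf a^H\mathbf h\mathbf h^H\mathbf a+\sigma_w^2}\right)P$$ over $\mathbf a\in\mathbb C^N$ subject to $\mathbf a^H\mathbf D\mathbf a\le P_T$. Then $$\mathbf a^*=\sqrt{\frac{P_T}{\mathbf h^H\mathbf B^{-1}\mathbf D\mathbf B^{-1}\mathbf h}}\;\mathbf B^{-1}\mathbf h$$ is an optimal solution. It equivalently maximizes $$\frac{\mathbf a^H\mathbf h\mathbf h^H\mathbf a}{\mathbf a^H\mathbf H\mathbf V\mathbf H^H\mathbf a+\sigma_w^2}$$ subject to the same constraint, and the maximum value of this ratio is $\mathbf h^H\mathbf B^{-1}\mathbf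 h$.
   Context: $(\cdot)^H$ is the conjugate transpose. Setting: $N$ sensors observe a scalar parameter $\theta$ (variance $\sigma_\theta^2$) in independent noises of variances $\sigma_{v,i}^2$ and forward their observations with complex gains (whose conjugates form $\mathbf a$) over channels $h_i$ to a fusion center with noise variance $\sigma_w^2$. The fusion center runs a Kalman filter; $P$ denotes the prediction MSE $P_{n|n-1}$, $\mathrm{MSE}(\mathbf a)$ the filtered MSE $P_{n|n}$, and $\mathbf a^H\mathbf D\mathbf a$ is the total transmit power. The time index $n$ is fixed and suppressed. *)

theory Defs
  imports "HOL-Analysis.Analysis"
begin

definition diag :: "complex ^ 'n \<Rightarrow> complex ^ 'n ^ 'n" where
  "diag v = (\<chi> i j. if i = j then v $ i else 0)"

definition of_real_vec :: "real ^ 'n \<Rightarrow> complex ^ 'n" where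
  "of_real_vec v = (\<chi> i. complex_of_real (v $ i))"

definition ctranspose :: "complex ^ 'n ^ 'm \<Rightarrow> complex ^ 'm ^ 'n" where
  "ctranspose A = (\<chi> i j. cnj (A $ j $ i))"

text \<open>The scalar \<open>x\<^sup>H y\<close> and the matrix \<open>x y\<^sup>H\<close>.\<close>

definition cdot :: "complex ^ 'n \<Rightarrow> complex ^ 'n \<Rightarrow> complex" where
  "cdot x y = (\<Sum>i\<in>UNIV. cnj (x $ i) * y $ i)"

definition couter :: "complex ^ 'm \<Rightarrow> complex ^ 'n \<Rightarrow> complex ^ 'n ^ 'm" where
  "couter x y = (\<chi> i j. x $ i * cnj (y $ j))"

text \<open>The quadratic form \<open>a\<^sup>H A a\<close> as a real number. It is only used for Hermitian \<open>A\<close>,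
  where taking the real part loses nothing (lemma \<open>of_real_qform\<close>).\<close>

definition qform :: "complex ^ 'n ^ 'n \<Rightarrow> complex ^ 'n \<Rightarrow> real" where
  "qform A a = Re (cdot a (A *v a))"

lemma of_real_qform:
  assumes "ctranspose A = A"
  shows "complex_of_real (qform A a) = cdot a (A *v a)"
proof -
  have A: "cnj (A $ i $ j) = A $ j $ i" for i j
    using assms by (metis (no_types, lifting) ctranspose_def vec_lambda_beta)
  have "cnj (cdot a (A *v a)) = (\<Sum>i\<in>UNIV. \<Sum>j\<in>UNIV. a $ i * (A $ j $ i * cnj (a $ j)))"
    by (simp add: cdot_def matrix_vector_mult_def A sum_distrib_left)
  also have "\<dots> = (\<Sum>j\<in>UNIV. \<Sum>i\<in>UNIV. a $ i * (A $ j $ i * cnj (a $ j)))"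
    by (rule sum.swap)
  also have "\<dots> = cdot a (A *v a)"
    by (simp add: cdot_def matrix_vector_mult_def sum_distrib_left mult_ac)
  finally show ?thesis
    by (simp add: qform_def complex_eq_iff)
qed

lemma ctranspose_diag_of_real: "ctranspose (diag (of_real_vec v)) = diag (of_real_vec v)"
  by (simp add: ctranspose_def diag_def of_real_vec_def vec_eq_iff)

lemma ctranspose_couter: "ctranspose (couter h h) = couter h h"
  by (simp add: ctranspose_def couter_def vec_eq_iff mult.commute)

lemma ctranspose_mult: "ctranspose (A ** B) = ctranspose B ** ctranspose A"
  by (simp add: ctranspose_def vec_eq_iff matrix_matrix_mult_def mult.commute)

lemma ctranspose_ctranspose: "ctranspose (ctranspose A) = A"
  by (simp add: ctranspose_def vec_eq_iff)

lemma ctranspose_congruence: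
  "ctranspose V = V \<Longrightarrow> ctranspose (H ** V ** ctranspose H) = H ** V ** ctranspose H"
  by (simp only: ctranspose_mult ctranspose_ctranspose matrix_mul_assoc)

lemma ctranspose_matrix_inv:
  fixes B :: "complex ^ 'n ^ 'n"
  assumes "ctranspose B = B" and "invertible B"
  shows "ctranspose (matrix_inv B) = matrix_inv B"
proof -
  have inv: "B ** matrix_inv B = mat 1"
    using someI_ex[OF assms(2)[unfolded invertible_def]] unfolding matrix_inv_def by blast
  have one: "ctranspose (mat 1 :: complex ^ 'n ^ 'n) = mat 1"
    by (auto simp: ctranspose_def mat_def vec_eq_iff)
  have "ctranspose (matrix_inv B) ** B = mat 1"
    using arg_cong[OF inv, of ctranspose] assms(1) one
    by (simp add: ctranspose_mult)
  then have "ctranspose (matrix_inv B) = ctranspose (matrix_inv B) ** (B ** matrix_inv B)"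
    by (simp add: inv)
  also have "\<dots> = matrix_inv B"
    by (simp add: matrix_mul_assoc \<open>ctranspose (matrix_inv B) ** B = mat 1\<close>)
  finally show ?thesis .
qed

text \<open>Filtered MSE and signal-to-noise ratio, for noise matrix \<open>R = H V H\<^sup>H\<close>, fusion center
  noise variance \<open>sw2\<close> and prediction MSE \<open>P\<close>.\<close>

definition MSE ::
  "complex ^ 'n \<Rightarrow> complex ^ 'n ^ 'n \<Rightarrow> real \<Rightarrow> real \<Rightarrow> complex ^ 'n \<Rightarrow> real" where
  "MSE h R sw2 P a =
     (1 - P * qform (couter h h) a / (qform R a + P * qform (couter h h) a + sw2)) * P"

definition SNR :: "complex ^ 'n \<Rightarrow> complex ^ 'n ^ 'n \<Rightarrow> real \<Rightarrow> complex ^ 'n \<Rightarrow> real" where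
  "SNR h R sw2 a = qform (couter h h) a / (qform R a + sw2)"

end

(* Feasibility gives sw2 >= (sw2 / P_T) * a^H D a, so the SNR denominator is at least a^H B a, with
   equality when the power constraint is active. Cauchy-Schwarz in the B-inner product bounds
   |h^H a|^2 / a^H B a by h^H B^{-1} h, with equality for multiples of B^{-1} h, and the square-root
   factor in a_opt makes the constraint active. Moreover MSE = P / (1 + P * SNR) is a strictly
   decreasing function of the SNR. *)
theory Submission
  imports Defs
begin

abbreviation rdiag :: "real ^ 'n \<Rightarrow> complex ^ 'n ^ 'n" where
  "rdiag v \<equiv> diag (of_real_vec v)"

lemma diag_mult_diag: "diag u ** diag v = diag (\<chi> i. u $ i * v $ i)"
proof -
  have "(\<Sum>k\<in>UNIV. (if i = k then u $ i else 0) * (if k = j then v $ k else 0)) =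
      (if i = j then u $ i * v $ i else 0)" for i j
  proof -
    have "(\<Sum>k\<in>UNIV. (if i = k then u $ i else 0) * (if k = j then v $ k else 0)) =
        (\<Sum>k\<in>UNIV. if i = k then u $ i * (if k = j then v $ k else 0) else 0)"
      by (rule sum.cong) auto
    then show ?thesis
      by simp
  qed
  then show ?thesis
    by (simp add: diag_def matrix_matrix_mult_def vec_eq_iff)
qed

lemma rdiag_mult_rdiag: "rdiag u ** rdiag v = rdiag (\<chi> i. u $ i * v $ i)"
  unfolding diag_mult_diag by (simp add: of_real_vec_def)

lemma diag_mult_vector: "diag u *v x = (\<chi> i. u $ i * x $ i)"
proof -
  have "(\<Sum>j\<in>UNIV. (if i = j then u $ i else 0) * x $ j) = u $ i * x $ i" for i
    by (simp add: if_distrib[of "\<lambda>z. z * _"] cong: if_cong)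
  then show ?thesis
    by (simp add: diag_def matrix_vector_mult_def vec_eq_iff)
qed

text \<open>\<open>matrix_inv\<close> is a choice among two-sided inverses. Uniqueness makes the
  choice harmless: multiplying \<open>A ** A' = mat 1\<close> on the left by the chosen inverse
  turns it into \<open>A'\<close>.\<close>

lemma matrix_inv_eqI:
  fixes A A' :: "'a::semiring_1 ^ 'n ^ 'n"
  assumes "A ** A' = mat 1" "A' ** A = mat 1"
  shows "matrix_inv A = A'"
proof -
  have "\<exists>A'. A ** A' = mat 1 \<and> A' ** A = mat 1"
    using assms by blast
  from someI_ex[OF this] have "matrix_inv A ** A = mat 1"
    unfolding matrix_inv_def by blast
  then show ?thesis
    using assms(1) by (metis matrix_mul_assoc matrix_mul_lid matrix_mul_rid)
qed

lemma matrix_inv_rdiag: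
  assumes "\<And>i. v $ i \<noteq> 0"
  shows "matrix_inv (rdiag v) = rdiag (\<chi> i. 1 / v $ i)"
proof -
  have "rdiag (\<chi> i. 1) = mat 1"
    by (simp add: diag_def of_real_vec_def mat_def vec_eq_iff)
  then show ?thesis
    using assms by (intro matrix_inv_eqI) (simp_all add: rdiag_mult_rdiag)
qed

text \<open>The phases of the channels cancel entrywise, leaving a real diagonal matrix. Hence
  \<open>B\<close> is real diagonal too, its inverse is explicit, and its quadratic form is a
  weighted sum of squared moduli.\<close>

lemma diag_rdiag_ctranspose_diag:
  "diag h ** rdiag v ** ctranspose (diag h) = rdiag (\<chi> i. (cmod (h $ i))\<^sup>2 * v $ i)"
proof -
  have "ctranspose (diag h) = diag (\<chi> i. cnj (h $ i))"
    by (simp add: ctranspose_def diag_def vec_eq_iff)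
  then show ?thesis
    by (simp add: diag_mult_diag of_real_vec_def complex_norm_square mult_ac del: of_real_power)
qed

text \<open>Stated over the complex numbers because \<open>qform\<close> records only the real part,
  whereas the optimal value is claimed as a complex equation.\<close>

lemma cdot_rdiag:
  "cdot a (rdiag v *v a) = complex_of_real (\<Sum>i\<in>UNIV. v $ i * (cmod (a $ i))\<^sup>2)"
  by (simp add: cdot_def diag_mult_vector of_real_vec_def complex_norm_square mult_ac
      del: of_real_power)

lemma qform_rdiag: "qform (rdiag v) a = (\<Sum>i\<in>UNIV. v $ i * (cmod (a $ i))\<^sup>2)"
  by (simp add: qform_def cdot_rdiag del: of_real_sum)

lemma qform_couter: "qform (couter h h) a = (cmod (cdot h a))\<^sup>2"
proof -
  have "cdot a (couter h h *v a) = cnj (cdot h a) * cdot h a"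
    by (simp add: cdot_def couter_def matrix_vector_mult_def sum_distrib_left sum_distrib_right
        mult_ac)
  also have "\<dots> = complex_of_real ((cmod (cdot h a))\<^sup>2)"
    by (metis complex_norm_square mult.commute)
  finally show ?thesis
    by (simp add: qform_def del: of_real_power)
qed

lemma qform_scaleR: "qform A (r *\<^sub>R a) = r\<^sup>2 * qform A a"
proof -
  have "cdot (r *\<^sub>R a) (A *v (r *\<^sub>R a)) = complex_of_real (r\<^sup>2) * cdot a (A *v a)"
    unfolding cdot_def matrix_vector_mult_def
    by (simp add: scaleR_conv_of_real[where 'a = complex] sum_distrib_left power2_eq_square mult_ac)
  then show ?thesis
    by (simp add: qform_def del: of_real_power)
qed

lemma cdot_Cauchy_Schwarz_weighted:
  fixes b :: "real ^ 'n"
  assumes "\<And>i. b $ i > 0"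
  shows "(cmod (cdot h a))\<^sup>2 \<le> qform (rdiag (\<chi> i. 1 / b $ i)) h * qform (rdiag b) a"
proof -
  \<comment> \<open>Each product of moduli is split symmetrically, so that the unweighted real
    Cauchy-Schwarz inequality produces the weights \<open>1 / b $ i\<close> and
    \<open>b $ i\<close>.\<close>
  let ?x = "\<lambda>i. cmod (h $ i) / sqrt (b $ i)"
  let ?y = "\<lambda>i. sqrt (b $ i) * cmod (a $ i)"
  have nz: "b $ i \<noteq> 0" for i
    using assms[of i] by simp
  have "cmod (cdot h a) \<le> (\<Sum>i\<in>UNIV. cmod (cnj (h $ i) * a $ i))"
    unfolding cdot_def by (rule norm_sum)
  also have "\<dots> = (\<Sum>i\<in>UNIV. ?x i * ?y i)"
    by (simp add: norm_mult nz)
  finally have "(cmod (cdot h a))\<^sup>2 \<le> (\<Sum>i\<in>UNIV. ?x i * ?y i)\<^sup>2"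
    by (simp add: power_mono)
  also have "\<dots> \<le> (\<Sum>i\<in>UNIV. (?x i)\<^sup>2) * (\<Sum>i\<in>UNIV. (?y i)\<^sup>2)"
    by (rule Cauchy_Schwarz_ineq_sum)
  also have "\<dots> = qform (rdiag (\<chi> i. 1 / b $ i)) h * qform (rdiag b) a"
    using assms by (simp add: qform_rdiag power_divide power_mult_distrib less_imp_le)
  finally show ?thesis .
qed

lemma SNR_nonneg: "qform R a \<ge> 0 \<Longrightarrow> sw2 > 0 \<Longrightarrow> SNR h R sw2 a \<ge> 0"
  by (simp add: SNR_def qform_couter)

text \<open>With q the signal term and m = \<open>qform R a + sw2\<close>, the factor 1 - P q / (m +
  P q) is m / (m + P q). Dividing through by m > 0 gives the claim.\<close>

lemma MSE_eq_SNR: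
  assumes "qform R a \<ge> 0" "sw2 > 0" "P > 0"
  shows "MSE h R sw2 P a = P / (1 + P * SNR h R sw2 a)"
proof -
  have den: "qform R a + sw2 > 0"
    using assms by simp
  have "P * qform (couter h h) a \<ge> 0"
    using assms by (simp add: qform_couter)
  with den have "qform R a + P * qform (couter h h) a + sw2 > 0"
    by linarith
  with den show ?thesis
    by (simp add: MSE_def SNR_def field_simps)
qed

lemma MSE_less_iff_SNR_greater:
  assumes "\<And>a. qform R a \<ge> 0" "sw2 > 0" "P > 0"
  shows "MSE h R sw2 P a < MSE h R sw2 P a' \<longleftrightarrow> SNR h R sw2 a > SNR h R sw2 a'"
proof -
  have "1 + P * SNR h R sw2 x > 0" for x
    using SNR_nonneg[of R x sw2 h] assms by (simp add: add_pos_nonneg)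
  then show ?thesis
    using assms by (simp add: MSE_eq_SNR divide_less_cancel field_simps)
qed

text \<open>Both notions of optimality say that no feasible point is strictly better, so reversing
  strict comparisons is enough; no existence of an optimum is involved.\<close>

lemma is_arg_min_MSE_iff_is_arg_max_SNR:
  assumes "\<And>a. qform R a \<ge> 0" "sw2 > 0" "P > 0"
  shows "is_arg_min (MSE h R sw2 P) Q a \<longleftrightarrow> is_arg_max (SNR h R sw2) Q a"
  using assms by (simp add: is_arg_min_def is_arg_max_def MSE_less_iff_SNR_greater)

theorem mainTheorem1:
  fixes h a_opt :: "complex ^ 'n"
    and stheta2 sw2 P P_T :: real
    and sv2 :: "real ^ 'n"
    and H V D B :: "complex ^ 'n ^ 'n"
  assumes "h \<noteq> 0"
    and "stheta2 > 0" and "sw2 > 0" and "\<And>i. sv2 $ i > 0" and "P > 0" and "P_T > 0"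
    and H: "H = diag h"
    and V: "V = diag (of_real_vec sv2)"
    and D: "D = diag (of_real_vec (\<chi> i. stheta2 + sv2 $ i))"
    and B: "B = H ** V ** ctranspose H + (sw2 / P_T) *\<^sub>R D"
    and a_opt: "a_opt =
      sqrt (P_T / qform (matrix_inv B ** D ** matrix_inv B) h) *\<^sub>R (matrix_inv B *v h)"
  shows "is_arg_min (MSE h (H ** V ** ctranspose H) sw2 P) (\<lambda>a. qform D a \<le> P_T) a_opt \<and>
    is_arg_max (SNR h (H ** V ** ctranspose H) sw2) (\<lambda>a. qform D a \<le> P_T) a_opt \<and>
    (\<forall>a. is_arg_min (MSE h (H ** V ** ctranspose H) sw2 P) (\<lambda>a. qform D a \<le> P_T) a \<longleftrightarrow>
         is_arg_max (SNR h (H ** V ** ctranspose H) sw2) (\<lambda>a. qform D a \<le> P_T) a) \<and>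
    complex_of_real (SNR h (H ** V ** ctranspose H) sw2 a_opt) = cdot h (matrix_inv B *v h)"
proof -
  define r :: "real ^ 'n" where "r = (\<chi> i. (cmod (h $ i))\<^sup>2 * sv2 $ i)"
  define d :: "real ^ 'n" where "d = (\<chi> i. stheta2 + sv2 $ i)"
  define b :: "real ^ 'n" where "b = r + (sw2 / P_T) *\<^sub>R d"
  let ?x = "matrix_inv B *v h"
  \<comment> \<open>\<open>g\<close> is the claimed maximum, \<open>t\<close> the power spent by the
    unscaled vector \<open>?x\<close>, and \<open>s\<close> the factor that brings this power to
    \<open>P_T\<close>.\<close>
  define g where "g = qform (matrix_inv B) h"
  define t where "t = qform D ?x"
  define s where "s = sqrt (P_T / t)"
  have r: "r $ i \<ge> 0" and d: "d $ i > 0" for i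
    using assms(2) assms(4)[of i] by (simp_all add: r_def d_def less_imp_le)
  have b: "b $ i > 0" for i
    using r[of i] d[of i] assms(3,6) by (simp add: b_def add_nonneg_pos)
  have b_nz: "b $ i \<noteq> 0" for i
    using b[of i] by simp
  have R_eq: "H ** V ** ctranspose H = rdiag r"
    by (simp add: H V r_def diag_rdiag_ctranspose_diag)
  have D_eq: "D = rdiag d"
    by (simp add: D d_def)
  have B_eq: "B = rdiag b"
    unfolding B R_eq D_eq
    by (simp add: b_def diag_def of_real_vec_def vec_eq_iff scaleR_conv_of_real[where 'a = complex])
  have inv: "matrix_inv B = rdiag (\<chi> i. 1 / b $ i)"
    unfolding B_eq by (rule matrix_inv_rdiag) (rule b_nz)
  have qB: "qform B a = qform (rdiag r) a + sw2 / P_T * qform D a" for a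
    by (simp add: B_eq D_eq qform_rdiag b_def sum_distrib_left sum.distrib algebra_simps)
  have R_nonneg: "qform (rdiag r) a \<ge> 0" for a
    unfolding qform_rdiag by (intro sum_nonneg mult_nonneg_nonneg r) simp
  \<comment> \<open>A nonzero channel contributes a strictly positive term to the sums for
    \<open>g\<close> and \<open>t\<close>; all other terms are nonnegative.\<close>
  obtain k where k: "h $ k \<noteq> 0"
    using assms(1) by (auto simp: vec_eq_iff)
  have x: "?x $ i = h $ i / of_real (b $ i)" for i
    by (simp add: inv diag_mult_vector of_real_vec_def)
  have cdot_x: "cdot h ?x = complex_of_real g"
    unfolding g_def qform_def inv cdot_rdiag by simp
  have qB_x: "qform B ?x = g"
  proof -
    have "qform B ?x = (\<Sum>i\<in>UNIV. b $ i * (cmod (?x $ i))\<^sup>2)"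
      by (subst (1) B_eq) (rule qform_rdiag)
    also have "\<dots> = (\<Sum>i\<in>UNIV. 1 / b $ i * (cmod (h $ i))\<^sup>2)"
      by (simp add: x norm_divide power_divide power2_eq_square b_nz)
    also have "\<dots> = g"
      by (simp add: g_def inv qform_rdiag)
    finally show ?thesis .
  qed
  have g_pos: "g > 0"
    unfolding g_def inv qform_rdiag
    using b k by (intro sum_pos2[of _ k]) (simp_all add: less_imp_le)
  have t_pos: "t > 0"
    unfolding t_def D_eq qform_rdiag
    using d k b_nz[of k] by (intro sum_pos2[of _ k]) (simp_all add: x less_imp_le)
  \<comment> \<open>As \<open>matrix_inv B\<close> is real diagonal, it can be moved onto both
    copies of \<open>h\<close>: the normalizer in \<open>a_opt\<close> is the power of
    \<open>?x\<close>.\<close>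
  have "qform (matrix_inv B ** D ** matrix_inv B) h = t"
    unfolding t_def inv D_eq rdiag_mult_rdiag qform_rdiag
    by (simp add: inv[symmetric] x norm_divide power_divide power2_eq_square)
  then have a_opt': "a_opt = s *\<^sub>R ?x"
    by (simp add: a_opt s_def)
  have s2: "s\<^sup>2 = P_T / t"
    using t_pos assms(6) by (simp add: s_def)
  have s2_pos: "s\<^sup>2 > 0"
    using t_pos assms(6) by (simp add: s2)
  have active: "qform D a_opt = P_T"
    using t_pos by (simp add: a_opt' qform_scaleR s2 flip: t_def)
  have num: "qform (couter h h) a_opt = s\<^sup>2 * g\<^sup>2"
    by (simp add: a_opt' qform_scaleR qform_couter cdot_x)
  have "qform (rdiag r) a_opt + sw2 = qform B a_opt"
    using assms(6) by (simp add: qB active)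
  also have "\<dots> = s\<^sup>2 * g"
    by (simp add: a_opt' qform_scaleR qB_x)
  \<comment> \<open>The ratio is s^2 g^2 / (s^2 g); the scale cancels because \<open>s\<close> and
    \<open>g\<close> are nonzero.\<close>
  finally have SNR_opt: "SNR h (rdiag r) sw2 a_opt = g"
    using s2_pos g_pos by (simp add: SNR_def num) (simp add: power2_eq_square)
  have bound: "SNR h (rdiag r) sw2 a \<le> g" if "qform D a \<le> P_T" for a
  proof -
    have "sw2 / P_T * qform D a \<le> sw2 / P_T * P_T"
      using that assms(3,6) by (intro mult_left_mono) simp_all
    then have "qform B a \<le> qform (rdiag r) a + sw2"
      using assms(6) by (simp add: qB)
    then have "g * qform B a \<le> g * (qform (rdiag r) a + sw2)"
      using g_pos by simp
    moreover have "qform (couter h h) a \<le> g * qform B a"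
      unfolding qform_couter g_def inv unfolding B_eq by (rule cdot_Cauchy_Schwarz_weighted) (rule b)
    \<comment> \<open>The denominator of the ratio is positive, so it can be cleared and the two
      inequalities chained.\<close>
    ultimately show ?thesis
      using R_nonneg[of a] assms(3) by (simp add: SNR_def divide_le_eq add_nonneg_pos)
  qed
  have "is_arg_max (SNR h (rdiag r) sw2) (\<lambda>a. qform D a \<le> P_T) a_opt"
    using bound by (fastforce simp: is_arg_max_def active SNR_opt not_less)
  then show ?thesis
    unfolding R_eq
    using is_arg_min_MSE_iff_is_arg_max_SNR[OF R_nonneg assms(3,5)] SNR_opt cdot_x by simp
qed

end
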